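(* Let $A=(0,a_2,a_3,\dots)$ be a sequence of nonnegative integers (with $a_1=0$). For all $z\in\mathbb C$ with $|z|\leqslant1$, $$\sum_{m=0}^{\infty}e_{A,m}z^{m}=\prod_{p} \biggl(1-\frac{1}{p^2}+\sum_{j=2}^{\infty}z^{a_j} \Bigl(\frac{1}{p^{j}}-\frac{1}{p^{j+1}} \Bigr)\biggr).$$
   Context: For a positive integer $n$ and $j\geqslant1$, $\omega_j(n)$ is the number of primes $p$ with $p^j\,\|\,n$ (primes dividing $n$ with multiplicity exactly $j$). For a sequence $A=(a_1,a_2,\dots)$, $\omega_A(n)=\sum_{j=1}^\infty a_j\omega_j(n)$ (a finite sum for each $n$). $e_{A,m}=\lim_{x\to\infty}\frac1x\#\{n\leqslant x:\omega_A(n)=m\}$ is the natural density of the positive integers $n$ with $\omega_A(n)=m$ (this limit exists when $a_1=0$). $\prod_p$ denotes a product over all primes. By convention $z^0=1$, including for $z=0$. *)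

theory Defs
  imports "HOL-Analysis.Analysis" "HOL-Number_Theory.Number_Theory"
begin

definition omega_exact :: "nat \<Rightarrow> nat \<Rightarrow> nat" where
  "omega_exact j n = card {p. prime p \<and> multiplicity p n = j}"

text \<open>
  A sequence \<open>a\<^sub>1, a\<^sub>2, \<dots>\<close> is a function \<open>A\<close> on the naturals with \<open>a\<^sub>j = A j\<close> for \<open>j \<ge> 1\<close>;
  the value \<open>A 0\<close> is never used. For \<open>n > 0\<close> the series below has only finitely many
  nonzero terms.
\<close>

definition omega_seq :: "(nat \<Rightarrow> nat) \<Rightarrow> nat \<Rightarrow> nat" where
  "omega_seq A n = (\<Sum>j. A (Suc j) * omega_exact (Suc j) n)"

definition omega_proportion :: "(nat \<Rightarrow> nat) \<Rightarrow> nat \<Rightarrow> real \<Rightarrow> real" where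
  "omega_proportion A m x = real (card {n. 0 < n \<and> real n \<le> x \<and> omega_seq A n = m}) / x"

definition omega_density :: "(nat \<Rightarrow> nat) \<Rightarrow> nat \<Rightarrow> real" where
  "omega_density A m = Lim at_top (omega_proportion A m)"

definition euler_factor :: "(nat \<Rightarrow> nat) \<Rightarrow> complex \<Rightarrow> nat \<Rightarrow> complex" where
  "euler_factor A z p =
     1 - 1 / of_nat p ^ 2 + (\<Sum>j. z ^ A (j + 2) * (1 / of_nat p ^ (j + 2) - 1 / of_nat p ^ (j + 3)))"

end

theory Submission imports Defs
begin

text \<open>
  The values \<open>omega_seq A n\<close> are determined by the multiplicities of the primes in \<open>n\<close>. In density,
  the multiplicity of \<open>p\<close> equals \<open>j\<close> with probability \<open>1 / p ^ j - 1 / p ^ (j + 1)\<close>, independently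
  for different primes. The identity says that the generating function of a sum of independent
  variables is the product of their generating functions. What has to be justified is the passage
  from finitely many primes and bounded multiplicities, where all is periodic, to the limit.

  Let \<open>Q = cutoff_modulus k\<close> be the product of \<open>p ^ (2 * k)\<close> over the primes \<open>p \<le> k\<close>, and compare
  \<open>omega_seq A n\<close> with \<open>omega_seq A (gcd n Q)\<close>, which has period \<open>Q\<close> in \<open>n\<close>.

  \<^item> Since \<open>a\<^sub>1 = 0\<close>, the two differ only if \<open>n\<close> is divisible by the square of some \<open>d > k\<close>
    (\<open>large_square_divisor_if_omega_seq_gcd_neq\<close>). At most \<open>x / k\<close> integers up to \<open>x\<close> are of this kind
    (\<open>card_large_square_divisor_le\<close>), so the two distributions of values up to \<open>x\<close> differ in total by
    at most \<open>2 / k\<close>, uniformly in \<open>x\<close> (\<open>sum_abs_omega_proportion_diff_le\<close>). Hence the densities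
    exist (\<open>omega_proportion_tendsto\<close>), and for \<open>\<bar>z\<bar> \<le> 1\<close> their generating function is within
    \<open>2 / k\<close> of that of the truncated densities (\<open>norm_density_series_minus_gcd_mean_le\<close>).

  \<^item> The truncated generating function is the mean of the multiplicative function
    \<open>d \<mapsto> z ^ omega_seq A d\<close> at \<open>d = gcd n Q\<close> over a period. By the Chinese remainder theorem it is a
    product over \<open>p \<le> k\<close> (\<open>gcd_mean_prod_prime_powers\<close>). Each of its factors is
    within \<open>2 / p ^ (2 * k)\<close> of the Euler factor, so the product tends to the Euler product
    (\<open>gcd_mean_cutoff_modulus_tendsto\<close>).

  Both estimates are for the same quantity, and \<open>k \<rightarrow> \<infinity>\<close> gives the identity.
\<close>

section \<open>The additive function and its periodic truncation\<close>

lemma omega_seq_eq_sum_prime_factors: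
  "omega_seq A n = (\<Sum>p\<in>prime_factors n. A (multiplicity p n))"
proof -
  define N where "N = Suc (\<Sum>p\<in>prime_factors n. multiplicity p n)"
  have bound: "multiplicity p n < N" if "p \<in> prime_factors n" for p
    unfolding N_def less_Suc_eq_le
    using member_le_sum[of p "prime_factors n" "\<lambda>p. multiplicity p n"] that by simp
  have set: "{p. prime p \<and> multiplicity p n = Suc j} = {p \<in> prime_factors n. multiplicity p n = Suc j}"
    for j by (auto simp: prime_factors_multiplicity)
  have empty: "{p. prime p \<and> multiplicity p n = Suc j} = {}" if "j \<ge> N" for j
    using bound that unfolding set by fastforce
  have "omega_seq A n = (\<Sum>j<N. A (Suc j) * omega_exact (Suc j) n)"
    unfolding omega_seq_def omega_exact_def
    by (intro suminf_finite) (auto simp only: finite_lessThan lessThan_iff not_less empty card.empty mult_0_right)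
  also have "\<dots> = (\<Sum>j<N. \<Sum>p\<in>{p \<in> prime_factors n. multiplicity p n = Suc j}. A (multiplicity p n))"
    unfolding omega_exact_def set by (intro sum.cong) auto
  also have "\<dots> = (\<Sum>i\<in>Suc ` {..<N}. \<Sum>p\<in>{p \<in> prime_factors n. multiplicity p n = i}. A (multiplicity p n))"
    by (subst sum.reindex) auto
  also have "\<dots> = (\<Sum>p\<in>prime_factors n. A (multiplicity p n))"
  proof (intro sum.group)
    show "(\<lambda>p. multiplicity p n) ` prime_factors n \<subseteq> Suc ` {..<N}"
    proof safe
      fix p assume p: "p \<in> prime_factors n"
      hence "multiplicity p n > 0" by (simp add: prime_factors_multiplicity)
      with bound[OF p] show "multiplicity p n \<in> Suc ` {..<N}"
        by (intro image_eqI[of _ _ "multiplicity p n - 1"]) auto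
    qed
  qed auto
  finally show ?thesis .
qed

lemma omega_seq_1 [simp]: "omega_seq A (Suc 0) = 0"
  by (simp add: omega_seq_eq_sum_prime_factors)

lemma omega_seq_mult_coprime:
  assumes "coprime a b" "a > 0" "b > 0"
  shows "omega_seq A (a * b) = omega_seq A a + omega_seq A b"
proof -
  have disj: "prime_factors a \<inter> prime_factors b = {}"
    using assms(1) by (meson coprime_common_divisor disjoint_iff in_prime_factors_imp_dvd
        in_prime_factors_imp_prime not_prime_unit)
  have zero: "multiplicity p y = 0" if "coprime x y" "p \<in> prime_factors x" for x y p :: nat
    using that by (metis coprime_common_divisor in_prime_factors_iff not_dvd_imp_multiplicity_0
        not_prime_unit)
  have mult: "multiplicity p (a * b) = multiplicity p a + multiplicity p b"
    if "p \<in> prime_factors a \<union> prime_factors b" for p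
    using that assms by (intro prime_elem_multiplicity_mult_distrib) (auto simp: in_prime_factors_imp_prime)
  have "omega_seq A (a * b) =
     (\<Sum>p\<in>prime_factors a. A (multiplicity p (a * b))) + (\<Sum>p\<in>prime_factors b. A (multiplicity p (a * b)))"
    using assms disj
    by (simp add: omega_seq_eq_sum_prime_factors prime_factors_product sum.union_disjoint)
  also have "(\<Sum>p\<in>prime_factors a. A (multiplicity p (a * b))) = omega_seq A a"
    unfolding omega_seq_eq_sum_prime_factors
    using zero[OF assms(1)] assms
    by (intro sum.cong) (auto simp: mult)
  also have "(\<Sum>p\<in>prime_factors b. A (multiplicity p (a * b))) = omega_seq A b"
    unfolding omega_seq_eq_sum_prime_factors
    using zero[of b a] assms
    by (intro sum.cong) (auto simp: mult coprime_commute)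
  finally show ?thesis .
qed

lemma omega_seq_prime_power:
  assumes "prime p"
  shows "omega_seq A (p ^ j) = (if j = 0 then 0 else A j)"
  using assms
  by (auto simp: omega_seq_eq_sum_prime_factors prime_factors_power prime_prime_factors)

text \<open>
  Since \<open>a\<^sub>1 = 0\<close>, only primes whose square divides \<open>n\<close> are seen. This is what makes the
  truncation below wrong only on a sparse set.
\<close>

lemma omega_seq_eq_sum_multiplicity_ge_2:
  assumes "A 1 = 0"
  shows "omega_seq A n = (\<Sum>p | prime p \<and> 2 \<le> multiplicity p n. A (multiplicity p n))"
proof -
  have "A (multiplicity p n) = 0" if "prime p" "multiplicity p n > 0" "\<not> 2 \<le> multiplicity p n" for p
  proof -
    have "multiplicity p n = 1" using that by linarith
    thus ?thesis using assms by simp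
  qed
  thus ?thesis
    unfolding omega_seq_eq_sum_prime_factors
    by (intro sum.mono_neutral_right finite_set_mset) (auto simp: prime_factors_multiplicity)
qed

text \<open>
  Replacing \<open>n\<close> by \<open>gcd n Q\<close> caps every multiplicity at that in \<open>Q\<close>. The exponent \<open>2 * k\<close>, rather
  than \<open>k\<close>, ensures that a multiplicity above the cap yields a square divisor \<open>(p ^ k)\<^sup>2\<close> with
  \<open>p ^ k > k\<close>, so that primes above \<open>k\<close> and capped multiplicities can be treated alike.
\<close>

definition cutoff_modulus :: "nat \<Rightarrow> nat" where
  "cutoff_modulus k = (\<Prod>p | prime p \<and> p \<le> k. p ^ (2 * k))"

lemma cutoff_modulus_pos: "cutoff_modulus k > 0"
  unfolding cutoff_modulus_def by (intro prod_pos) (auto simp: prime_gt_0_nat)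

text \<open>
  Suppose that no square of a number above \<open>k\<close> divides \<open>n\<close>. A prime with multiplicity at least 2 is
  then at most \<open>k\<close>, and its multiplicity is at most \<open>2 * k\<close>; so the truncation leaves it unchanged.
  Primes of multiplicity 1 may disappear, but they contribute \<open>a\<^sub>1 = 0\<close>.
\<close>

lemma large_square_divisor_if_omega_seq_gcd_neq:
  assumes "A 1 = 0" "n > 0" "omega_seq A (gcd n (cutoff_modulus k)) \<noteq> omega_seq A n"
  shows "\<exists>d>k. d ^ 2 dvd n"
proof (rule ccontr)
  assume contr: "\<not> ?thesis"
  have mult_Q: "multiplicity p (cutoff_modulus k) = (if p \<le> k then 2 * k else 0)" if "prime p" for p
    unfolding cutoff_modulus_def using that by (subst multiplicity_prod_prime_powers) auto
  have mult_gcd: "multiplicity p (gcd n (cutoff_modulus k)) =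
      min (multiplicity p n) (if p \<le> k then 2 * k else 0)" if "prime p" for p
    using that assms(2) cutoff_modulus_pos[of k] by (subst multiplicity_gcd) (auto simp: mult_Q)
  have small: "p \<le> k \<and> multiplicity p n \<le> 2 * k" if p: "prime p" "2 \<le> multiplicity p n" for p
  proof
    have "p ^ 2 dvd n" using p(2) by (rule multiplicity_dvd')
    thus "p \<le> k" using contr by (meson not_le)
    show "multiplicity p n \<le> 2 * k"
    proof (rule ccontr)
      assume "\<not> ?thesis"
      hence "p ^ (k * 2) dvd n" by (intro multiplicity_dvd') simp
      moreover have "k < p ^ k" using prime_gt_1_nat[OF p(1)] by (intro power_gt_expt) simp
      ultimately show False using contr by (auto simp: power_mult)
    qed
  qed
  have same: "multiplicity p (gcd n (cutoff_modulus k)) = multiplicity p n"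
    if "prime p" "2 \<le> multiplicity p n" for p
    using small[OF that] mult_gcd[OF that(1)] by simp
  have "2 \<le> multiplicity p (gcd n (cutoff_modulus k)) \<longleftrightarrow> 2 \<le> multiplicity p n"
    if "prime p" for p
    using same[OF that] mult_gcd[OF that] by linarith
  hence "{p. prime p \<and> 2 \<le> multiplicity p (gcd n (cutoff_modulus k))} =
      {p. prime p \<and> 2 \<le> multiplicity p n}" by blast
  hence "omega_seq A (gcd n (cutoff_modulus k)) = omega_seq A n"
    unfolding omega_seq_eq_sum_multiplicity_ge_2[of A, OF assms(1)] by (intro sum.cong) (auto simp: same)
  with assms(3) show False ..
qed

section \<open>Means of multiplicative functions over a full period\<close>

text \<open>
  The Chinese remainder theorem, as a reindexing of sums over residues.
\<close>

lemma sum_residues_mult_coprime: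
  fixes f :: "nat \<Rightarrow> nat \<Rightarrow> 'a::comm_monoid_add"
  assumes "coprime a b" "a > 0" "b > 0"
  shows "(\<Sum>n<a * b. f (n mod a) (n mod b)) = (\<Sum>i<a. \<Sum>j<b. f i j)"
proof -
  let ?h = "\<lambda>n. (n mod a, n mod b)"
  have inj: "inj_on ?h {..<a * b}"
  proof (rule inj_onI)
    fix x y assume xy: "x \<in> {..<a * b}" "y \<in> {..<a * b}" "?h x = ?h y"
    hence "[x = y] (mod a)" "[x = y] (mod b)" by (auto simp: cong_def)
    hence "[x = y] (mod a * b)" using assms(1) by (rule coprime_cong_mult_nat)
    thus "x = y" using xy by (simp add: cong_def)
  qed
  have "?h ` {..<a * b} = {..<a} \<times> {..<b}"
    by (rule card_subset_eq) (use assms in \<open>auto simp: card_image[OF inj]\<close>)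
  with inj have "bij_betw ?h {..<a * b} ({..<a} \<times> {..<b})" by (simp add: bij_betw_def)
  from sum.reindex_bij_betw[OF this, of "\<lambda>(i, j). f i j"] show ?thesis
    by (simp add: sum.cartesian_product)
qed

definition gcd_mean :: "(nat \<Rightarrow> complex) \<Rightarrow> nat \<Rightarrow> complex" where
  "gcd_mean f Q = (\<Sum>n<Q. f (gcd n Q)) / of_nat Q"

lemma norm_gcd_mean_le_1:
  assumes "\<And>d. norm (f d) \<le> 1"
  shows "norm (gcd_mean f Q) \<le> 1"
proof -
  have "norm (\<Sum>n<Q. f (gcd n Q)) \<le> (\<Sum>n<Q. 1)"
    by (intro sum_norm_le) (use assms in auto)
  thus ?thesis by (simp add: gcd_mean_def norm_divide divide_le_eq)
qed

lemma gcd_mult_right_coprime: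
  fixes a b n :: nat
  assumes "coprime a b"
  shows "gcd n (a * b) = gcd n a * gcd n b"
proof (rule dvd_antisym)
  obtain d e where de: "gcd n (a * b) = d * e" "d dvd a" "e dvd b"
    using division_decomp[OF gcd_dvd2[of n "a * b"]] by blast
  moreover have "d * e dvd n" unfolding de(1)[symmetric] by (rule gcd_dvd1)
  ultimately show "gcd n (a * b) dvd gcd n a * gcd n b"
    by (metis dvd_mult_left dvd_mult_right gcd_greatest mult_dvd_mono)
  have "coprime (gcd n a) (gcd n b)"
    using assms by (meson coprime_divisors gcd_dvd2)
  thus "gcd n a * gcd n b dvd gcd n (a * b)"
    by (intro gcd_greatest divides_mult mult_dvd_mono) auto
qed

text \<open>
  For coprime moduli \<open>gcd n (a * b)\<close> is the product of the coprime numbers \<open>gcd n a\<close> and \<open>gcd n b\<close>,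
  each of which depends only on its own residue of \<open>n\<close>; so the mean factorises as an expectation of
  independent variables does.
\<close>

lemma gcd_mean_mult_coprime:
  assumes mult: "\<And>a b. coprime a b \<Longrightarrow> a > 0 \<Longrightarrow> b > 0 \<Longrightarrow> f (a * b) = f a * f b"
    and "coprime a b" "a > 0" "b > 0"
  shows "gcd_mean f (a * b) = gcd_mean f a * gcd_mean f b"
proof -
  have "f (gcd n (a * b)) = f (gcd (n mod a) a) * f (gcd (n mod b) b)" for n
  proof -
    have "coprime (gcd n a) (gcd n b)"
      using assms(2) by (meson coprime_divisors gcd_dvd2)
    thus ?thesis using assms by (simp add: gcd_mult_right_coprime mult)
  qed
  hence "(\<Sum>n<a * b. f (gcd n (a * b))) = (\<Sum>i<a. f (gcd i a)) * (\<Sum>j<b. f (gcd j b))"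
    using sum_residues_mult_coprime[OF assms(2-4), of "\<lambda>i j. f (gcd i a) * f (gcd j b)"]
    by (simp add: sum_product)
  thus ?thesis by (simp add: gcd_mean_def)
qed

lemma gcd_mean_prod_prime_powers:
  assumes mult: "\<And>a b. coprime a b \<Longrightarrow> a > 0 \<Longrightarrow> b > 0 \<Longrightarrow> f (a * b) = f a * f b"
    and f1: "f 1 = 1"
    and "finite P" "\<And>p. p \<in> P \<Longrightarrow> prime p"
  shows "gcd_mean f (\<Prod>p\<in>P. p ^ K) = (\<Prod>p\<in>P. gcd_mean f (p ^ K))"
  using assms(3,4)
proof (induction P rule: finite_induct)
  case empty
  thus ?case using f1 by (simp add: gcd_mean_def)
next
  case (insert p P)
  have "coprime (p ^ K) (\<Prod>q\<in>P. q ^ K)"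
  proof (rule prod_coprime_right)
    fix q assume "q \<in> P"
    hence "coprime p q" using insert by (intro primes_coprime) auto
    thus "coprime (p ^ K) (q ^ K)" by simp
  qed
  moreover have "p ^ K > 0" "(\<Prod>q\<in>P. q ^ K) > 0"
    using insert.prems by (auto intro!: prod_pos simp: prime_gt_0_nat)
  ultimately show ?case
    using insert by (simp add: gcd_mean_mult_coprime[OF mult])
qed

text \<open>
  Among the residues modulo \<open>p ^ K\<close>, those with \<open>gcd\<close> equal to \<open>p ^ j\<close> number \<open>totient (p ^ (K - j))\<close>.
  Their proportion is \<open>1 / p ^ j - 1 / p ^ (j + 1)\<close> for \<open>j < K\<close>, whereas the capped
  multiplicity \<open>K\<close> collects the whole remaining mass \<open>1 / p ^ K\<close>.
\<close>

lemma gcd_mean_prime_power: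
  assumes "prime p"
  shows "gcd_mean f (p ^ K) =
    (\<Sum>j<K. f (p ^ j) * (1 / of_nat p ^ j - 1 / of_nat p ^ Suc j)) + f (p ^ K) / of_nat p ^ K"
proof -
  let ?Q = "p ^ K"
  have p: "p > 1" using assms by (rule prime_gt_1_nat)
  have Q: "?Q > 0" using p by simp
  \<comment> \<open>Represent the residue 0 by the modulus itself, to match the range of \<open>card_gcd_eq_totient\<close>.\<close>
  have "(\<Sum>n<?Q. f (gcd n ?Q)) = (\<Sum>n\<in>{0<..?Q}. f (gcd n ?Q))"
  proof -
    have "{..<?Q} = insert 0 {0<..<?Q}" "{0<..?Q} = insert ?Q {0<..<?Q}" using Q by auto
    thus ?thesis by simp
  qed
  also have "\<dots> = (\<Sum>d\<in>(\<lambda>j. p ^ j) ` {..K}. \<Sum>n | n \<in> {0<..?Q} \<and> gcd n ?Q = d. f (gcd n ?Q))"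
  proof (intro sum.group[symmetric] image_subsetI)
    fix n
    have "gcd n ?Q dvd ?Q" by simp
    then obtain j where "j \<le> K" "gcd n ?Q = p ^ j"
      unfolding divides_primepow_nat[OF assms] by blast
    thus "gcd n ?Q \<in> (\<lambda>j. p ^ j) ` {..K}" by auto
  qed auto
  also have "\<dots> = (\<Sum>j\<le>K. \<Sum>n | n \<in> {0<..?Q} \<and> gcd n ?Q = p ^ j. f (gcd n ?Q))"
    using p by (subst sum.reindex) (auto simp: inj_on_def)
  also have "\<dots> = (\<Sum>j\<le>K. of_nat (totient (p ^ (K - j))) * f (p ^ j))"
  proof (intro sum.cong refl)
    fix j assume "j \<in> {..K}"
    hence "card {n \<in> {0<..?Q}. gcd n ?Q = p ^ j} = totient (p ^ (K - j))"
      using p by (subst card_gcd_eq_totient) (auto simp: le_imp_power_dvd power_diff)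
    thus "(\<Sum>n | n \<in> {0<..?Q} \<and> gcd n ?Q = p ^ j. f (gcd n ?Q)) = of_nat (totient (p ^ (K - j))) * f (p ^ j)"
      by simp
  qed
  also have "\<dots> = (\<Sum>j<K. of_nat (totient (p ^ (K - j))) * f (p ^ j)) + f (p ^ K)"
    by (simp flip: lessThan_Suc_atMost)
  finally have "gcd_mean f ?Q =
      (\<Sum>j<K. of_nat (totient (p ^ (K - j))) * f (p ^ j) / of_nat ?Q) + f (p ^ K) / of_nat p ^ K"
    by (simp add: gcd_mean_def add_divide_distrib sum_divide_distrib)
  also have "(\<Sum>j<K. of_nat (totient (p ^ (K - j))) * f (p ^ j) / of_nat ?Q) =
      (\<Sum>j<K. f (p ^ j) * (1 / of_nat p ^ j - 1 / of_nat p ^ Suc j))"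
  proof (intro sum.cong refl)
    fix j assume "j \<in> {..<K}"
    hence "K = j + Suc (K - Suc j)" "K - j = Suc (K - Suc j)" by auto
    then obtain i where K: "K = j + Suc i" "K - j = Suc i" by metis
    have "of_nat p \<noteq> (0 :: complex)" using p by simp
    thus "of_nat (totient (p ^ (K - j))) * f (p ^ j) / of_nat ?Q =
        f (p ^ j) * (1 / of_nat p ^ j - 1 / of_nat p ^ Suc j)"
      using p unfolding K(2) totient_prime_power_Suc[OF assms] unfolding K(1)
      by (simp add: power_add divide_simps of_nat_diff)
  qed
  finally show ?thesis .
qed

section \<open>Convergence to the Euler product\<close>

text \<open>
  The weights \<open>1 / p ^ j - 1 / p ^ (j + 1)\<close> telescope, so those from \<open>K\<close> on have total mass
  \<open>1 / p ^ K\<close>. This one estimate bounds the Euler factor, its distance from 1 and the error made by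
  capping multiplicities.
\<close>

lemma power_tail_series:
  fixes c :: "nat \<Rightarrow> complex"
  assumes "p > 1" "\<And>j. norm (c j) \<le> B"
  shows "summable (\<lambda>j. c j * (1 / of_nat p ^ (j + K) - 1 / of_nat p ^ Suc (j + K)))"
    and "norm (\<Sum>j. c j * (1 / of_nat p ^ (j + K) - 1 / of_nat p ^ Suc (j + K))) \<le> B / p ^ K"
proof -
  define u where "u = (\<lambda>j. 1 / real p ^ (j + K))"
  have mono: "u (Suc j) \<le> u j" for j
    using assms(1) unfolding u_def by (intro divide_left_mono) auto
  have "(\<lambda>j. (1 / real p) ^ j * (1 / real p) ^ K) \<longlonglongrightarrow> 0 * (1 / real p) ^ K"
    using assms(1) by (intro tendsto_mult LIMSEQ_realpow_zero tendsto_const) auto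
  hence "u \<longlonglongrightarrow> 0"
    by (simp add: u_def power_add power_one_over)
  hence "(\<lambda>j. u j - u (Suc j)) sums (u 0 - 0)"
    by (rule telescope_sums')
  hence sums: "(\<lambda>j. B * (u j - u (Suc j))) sums (B / p ^ K)"
    by (auto simp: u_def dest: sums_mult[of _ _ B])
  have bound: "norm (c j * (1 / of_nat p ^ (j + K) - 1 / of_nat p ^ Suc (j + K)))
      \<le> B * (u j - u (Suc j))" for j
  proof -
    have "1 / of_nat p ^ (j + K) - 1 / of_nat p ^ Suc (j + K) = (of_real (u j - u (Suc j)) :: complex)"
      by (simp add: u_def)
    hence "norm (c j * (1 / of_nat p ^ (j + K) - 1 / of_nat p ^ Suc (j + K)))
      = norm (c j) * (u j - u (Suc j))"
      using mono[of j] by (simp only: norm_mult norm_of_real)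
    thus ?thesis using assms(2)[of j] mono[of j] by (auto intro: mult_right_mono)
  qed
  show "summable (\<lambda>j. c j * (1 / of_nat p ^ (j + K) - 1 / of_nat p ^ Suc (j + K)))"
    using sums_summable[OF sums] bound by (rule summable_comparison_test')
  show "norm (\<Sum>j. c j * (1 / of_nat p ^ (j + K) - 1 / of_nat p ^ Suc (j + K))) \<le> B / p ^ K"
    using norm_suminf_le[OF bound sums_summable[OF sums]] unfolding sums_unique[OF sums, symmetric] .
qed

text \<open>
  The leading term \<open>1 - 1 / p\<^sup>2\<close> of the Euler factor is the joint weight of the multiplicities 0 and 1,
  neither of which contributes to \<open>omega_seq\<close>. In this uniform shape the factor is the expectation of
  \<open>z ^ omega_seq A (p ^ j)\<close> over a random multiplicity \<open>j\<close>.
\<close>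

lemma euler_factor_eq_suminf:
  assumes "A 1 = 0" "norm z \<le> 1" "prime p"
  shows "euler_factor A z p =
    (\<Sum>j. z ^ omega_seq A (p ^ j) * (1 / of_nat p ^ j - 1 / of_nat p ^ Suc j))"
proof -
  let ?g = "\<lambda>j. z ^ omega_seq A (p ^ j) * (1 / of_nat p ^ j - 1 / of_nat p ^ Suc j)"
  have p: "p > 1" using assms(3) by (rule prime_gt_1_nat)
  have "summable ?g"
    using power_tail_series(1)[OF p, of "\<lambda>j. z ^ omega_seq A (p ^ j)" 1 0] assms(2)
    by (simp add: norm_power power_le_one)
  hence "suminf ?g = (\<Sum>j. ?g (j + 2)) + (\<Sum>j<2. ?g j)"
    by (rule suminf_split_initial_segment)
  also have "(\<Sum>j<2. ?g j) = 1 - 1 / of_nat p ^ 2"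
    using assms omega_seq_prime_power[OF assms(3), of A 1]
    by (simp add: numeral_2_eq_2)
  also have "(\<lambda>j. ?g (j + 2)) =
      (\<lambda>j. z ^ A (j + 2) * (1 / of_nat p ^ (j + 2) - 1 / of_nat p ^ (j + 3)))"
    by (simp add: omega_seq_prime_power[OF assms(3)] numeral_3_eq_3 del: power_Suc)
  finally show ?thesis unfolding euler_factor_def by simp
qed

lemma norm_euler_factor_le_1:
  assumes "A 1 = 0" "norm z \<le> 1" "prime p"
  shows "norm (euler_factor A z p) \<le> 1"
  using power_tail_series(2)[OF prime_gt_1_nat[OF assms(3)], of "\<lambda>j. z ^ omega_seq A (p ^ j)" 1 0] assms
  by (simp add: euler_factor_eq_suminf norm_power power_le_one)

text \<open>
  The two sides agree up to multiplicity \<open>K - 1\<close> and both have mass \<open>1 / p ^ K\<close> beyond.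
\<close>

lemma norm_gcd_mean_minus_euler_factor_le:
  assumes "A 1 = 0" "norm z \<le> 1" "prime p"
  shows "norm (gcd_mean (\<lambda>d. z ^ omega_seq A d) (p ^ K) - euler_factor A z p) \<le> 2 / p ^ K"
proof -
  let ?c = "\<lambda>j. z ^ omega_seq A (p ^ j)"
  let ?g = "\<lambda>j. ?c j * (1 / of_nat p ^ j - 1 / of_nat p ^ Suc j)"
  have p: "p > 1" using assms(3) by (rule prime_gt_1_nat)
  have c: "norm (?c j) \<le> 1" for j using assms(2) by (simp add: norm_power power_le_one)
  have "summable ?g"
    using power_tail_series(1)[OF p, of ?c 1 0] c by simp
  hence "suminf ?g = (\<Sum>j. ?g (j + K)) + (\<Sum>j<K. ?g j)"
    by (rule suminf_split_initial_segment)
  hence "gcd_mean (\<lambda>d. z ^ omega_seq A d) (p ^ K) - euler_factor A z p =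
      ?c K / of_nat p ^ K - (\<Sum>j. ?g (j + K))"
    unfolding gcd_mean_prime_power[OF assms(3)] euler_factor_eq_suminf[of A z p, OF assms] by simp
  moreover have "norm (?c K / of_nat p ^ K) \<le> 1 / p ^ K"
    using c[of K] p by (simp add: norm_divide norm_power divide_right_mono)
  moreover have "norm (\<Sum>j. ?g (j + K)) \<le> 1 / p ^ K"
    using power_tail_series(2)[OF p, of "\<lambda>j. ?c (j + K)" 1 K] c by simp
  moreover have "norm (?c K / of_nat p ^ K - (\<Sum>j. ?g (j + K)))
      \<le> norm (?c K / of_nat p ^ K) + norm (\<Sum>j. ?g (j + K))"
    by (rule norm_triangle_ineq4)
  ultimately show ?thesis by simp
qed

lemma norm_euler_factor_minus_1_le:
  assumes "norm z \<le> 1" "prime p"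
  shows "norm (euler_factor A z p - 1) \<le> 2 / p ^ 2"
proof -
  have p: "p > 1" using assms(2) by (rule prime_gt_1_nat)
  have eq: "euler_factor A z p - 1 =
      (\<Sum>j. z ^ A (j + 2) * (1 / of_nat p ^ (j + 2) - 1 / of_nat p ^ Suc (j + 2))) - 1 / of_nat p ^ 2"
    by (simp add: euler_factor_def numeral_3_eq_3)
  have "norm (euler_factor A z p - 1) \<le>
      norm (\<Sum>j. z ^ A (j + 2) * (1 / of_nat p ^ (j + 2) - 1 / of_nat p ^ Suc (j + 2)))
      + norm (1 / of_nat p ^ 2 :: complex)"
    unfolding eq by (rule norm_triangle_ineq4)
  also have "norm (\<Sum>j. z ^ A (j + 2) * (1 / of_nat p ^ (j + 2) - 1 / of_nat p ^ Suc (j + 2)))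
      \<le> 1 / p ^ 2"
    using assms(1) by (intro power_tail_series(2)[OF p]) (simp add: norm_power power_le_one)
  also have "norm (1 / of_nat p ^ 2 :: complex) = 1 / p ^ 2"
    by (simp add: norm_divide norm_power)
  finally show ?thesis by simp
qed

lemma convergent_prod_euler_factor:
  assumes "norm z \<le> 1"
  shows "convergent_prod (\<lambda>p. if prime p then euler_factor A z p else 1)"
proof -
  have "summable (\<lambda>p. 2 * inverse (real p ^ 2))"
    by (intro summable_mult inverse_power_summable) auto
  hence "summable (\<lambda>p. norm ((if prime p then euler_factor A z p else 1) - 1))"
  proof (rule summable_comparison_test[rotated], intro exI[of _ 0] allI impI)
    fix p :: nat
    show "norm (norm ((if prime p then euler_factor A z p else 1) - 1)) \<le> 2 * inverse (real p ^ 2)"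
      using norm_euler_factor_minus_1_le[OF assms, of p A] by (simp add: divide_inverse)
  qed
  hence "abs_convergent_prod (\<lambda>p. if prime p then euler_factor A z p else 1)"
    by (simp add: abs_convergent_prod_conv_summable)
  thus ?thesis by (rule abs_convergent_prod_imp_convergent_prod)
qed

text \<open>
  All factors lie in the unit disc, so the difference of the two finite products is at most the sum of
  the differences of their factors. There are at most \<open>k\<close> of these, each at most
  \<open>2 / p ^ (2 * k) \<le> 2 / k\<^sup>2\<close>.
\<close>

lemma gcd_mean_cutoff_modulus_tendsto:
  assumes "A 1 = 0" "norm z \<le> 1"
  shows "(\<lambda>k. gcd_mean (\<lambda>d. z ^ omega_seq A d) (cutoff_modulus k))
    \<longlonglongrightarrow> (\<Prod>p. if prime p then euler_factor A z p else 1)"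
proof -
  let ?F = "\<lambda>d. z ^ omega_seq A d"
  have "norm (gcd_mean ?F (cutoff_modulus k) -
      (\<Prod>p\<le>k. if prime p then euler_factor A z p else 1)) \<le> 2 / k" for k
  proof -
    let ?P = "{p. prime p \<and> p \<le> k}"
    have "norm (gcd_mean ?F (cutoff_modulus k) - (\<Prod>p\<le>k. if prime p then euler_factor A z p else 1))
      = norm ((\<Prod>p\<in>?P. gcd_mean ?F (p ^ (2 * k))) - (\<Prod>p\<in>?P. euler_factor A z p))"
    proof -
      have "gcd_mean ?F (cutoff_modulus k) = (\<Prod>p\<in>?P. gcd_mean ?F (p ^ (2 * k)))"
        unfolding cutoff_modulus_def
        by (intro gcd_mean_prod_prime_powers) (auto simp: omega_seq_mult_coprime power_add)
      moreover have "(\<Prod>p\<le>k. if prime p then euler_factor A z p else 1) = (\<Prod>p\<in>?P. euler_factor A z p)"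
        by (simp add: prod.If_cases Int_def conj_commute)
      ultimately show ?thesis by simp
    qed
    also have "\<dots> \<le> (\<Sum>p\<in>?P. norm (gcd_mean ?F (p ^ (2 * k)) - euler_factor A z p))"
      using assms
      by (intro norm_prod_diff norm_gcd_mean_le_1 norm_euler_factor_le_1)
         (auto simp: norm_power power_le_one)
    also have "\<dots> \<le> (\<Sum>p\<in>?P. 2 / k ^ 2)"
    proof (intro sum_mono)
      fix p assume p: "p \<in> ?P"
      hence k: "k > 0" using prime_gt_0_nat[of p] by auto
      have "k < p ^ k" using p prime_gt_1_nat[of p] by (intro power_gt_expt) auto
      hence "k ^ 2 \<le> (p ^ k) ^ 2" by (intro power_mono) auto
      hence "k ^ 2 \<le> p ^ (2 * k)" by (simp add: power_mult[symmetric] mult.commute)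
      hence "real k ^ 2 \<le> p ^ (2 * k)" by (simp flip: of_nat_power)
      hence "2 / real (p ^ (2 * k)) \<le> 2 / k ^ 2" using k p
        by (intro divide_left_mono) (auto simp: prime_gt_0_nat)
      thus "norm (gcd_mean ?F (p ^ (2 * k)) - euler_factor A z p) \<le> 2 / k ^ 2"
        using norm_gcd_mean_minus_euler_factor_le[of A z p "2 * k", OF assms] p by auto
    qed
    also have "\<dots> \<le> k * (2 / k ^ 2)"
    proof -
      have "card ?P \<le> card {1..k}"
        by (intro card_mono) (auto simp: prime_gt_0_nat Suc_le_eq)
      thus ?thesis unfolding sum_constant by (intro mult_right_mono) auto
    qed
    also have "\<dots> = 2 / k" by (simp add: power2_eq_square)
    finally show ?thesis .
  qed
  hence "(\<lambda>k. gcd_mean ?F (cutoff_modulus k) -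
      (\<Prod>p\<le>k. if prime p then euler_factor A z p else 1)) \<longlonglongrightarrow> 0"
    by (intro Lim_null_comparison[OF _ lim_const_over_n[of 2]] always_eventually) auto
  from tendsto_add[OF this convergent_prod_LIMSEQ[OF convergent_prod_euler_factor[of z A, OF assms(2)]]]
  show ?thesis by simp
qed

section \<open>Integers with a large square divisor\<close>

lemma sum_inverse_squares_tail_le:
  fixes k N :: nat
  assumes "k > 0"
  shows "(\<Sum>d\<in>{k<..N}. 1 / real d ^ 2) \<le> 1 / k"
proof -
  \<comment> \<open>The sharper bound is the one that an induction can carry, as
    \<open>1 / d\<^sup>2 \<le> 1 / (d - 1) - 1 / d\<close>.\<close>
  have "(\<Sum>d\<in>{k<..k + i}. 1 / real d ^ 2) \<le> 1 / k - 1 / (k + i)" for i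
  proof (induction i)
    case (Suc i)
    have "{k<..k + Suc i} = insert (k + Suc i) {k<..k + i}" by auto
    hence "(\<Sum>d\<in>{k<..k + Suc i}. 1 / real d ^ 2) \<le> 1 / real (k + Suc i) ^ 2 + (1 / k - 1 / (k + i))"
      using Suc.IH by simp
    also have "1 / real (k + Suc i) ^ 2 \<le> 1 / (real (k + i) * real (k + Suc i))"
      using assms unfolding power2_eq_square
      by (intro divide_left_mono mult_right_mono mult_pos_pos) auto
    also have "\<dots> = 1 / (k + i) - 1 / (k + Suc i)"
      using assms by (simp add: field_simps)
    finally show ?case by simp
  qed simp
  from this[of "N - k"] show ?thesis
    by (cases "k \<le> N") (auto intro: order_trans)
qed

lemma card_multiples_le:
  fixes m N :: nat
  assumes "m > 0"
  shows "card {n \<in> {0<..N}. m dvd n} \<le> N div m"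
proof -
  have "{n \<in> {0<..N}. m dvd n} \<subseteq> (\<lambda>i. m * i) ` {0<..N div m}"
  proof
    fix n assume "n \<in> {n \<in> {0<..N}. m dvd n}"
    then obtain i where "n = m * i" "0 < n" "n \<le> N" by (auto elim: dvdE)
    thus "n \<in> (\<lambda>i. m * i) ` {0<..N div m}"
      using assms by (auto simp: less_eq_div_iff_mult_less_eq mult.commute)
  qed
  hence "card {n \<in> {0<..N}. m dvd n} \<le> card ((\<lambda>i. m * i) ` {0<..N div m})"
    by (intro card_mono) auto
  also have "\<dots> \<le> card {0<..N div m}" by (rule card_image_le) simp
  finally show ?thesis by simp
qed

lemma card_large_square_divisor_le:
  fixes k N :: nat
  assumes "k > 0"
  shows "real (card {n \<in> {0<..N}. \<exists>d>k. d ^ 2 dvd n}) \<le> N / k"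
proof -
  have "{n \<in> {0<..N}. \<exists>d>k. d ^ 2 dvd n} \<subseteq> (\<Union>d\<in>{k<..N}. {n \<in> {0<..N}. d ^ 2 dvd n})"
  proof safe
    fix n d assume *: "n \<in> {0<..N}" "k < d" "d ^ 2 dvd n"
    have "d \<le> d ^ 2" using *(2) by (intro self_le_power) linarith+
    also have "\<dots> \<le> n" using * by (intro dvd_imp_le) auto
    finally show "n \<in> (\<Union>d\<in>{k<..N}. {n \<in> {0<..N}. d ^ 2 dvd n})" using * by auto
  qed
  hence "card {n \<in> {0<..N}. \<exists>d>k. d ^ 2 dvd n} \<le> card (\<Union>d\<in>{k<..N}. {n \<in> {0<..N}. d ^ 2 dvd n})"
    by (intro card_mono) auto
  also have "\<dots> \<le> (\<Sum>d\<in>{k<..N}. card {n \<in> {0<..N}. d ^ 2 dvd n})"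
    by (rule card_UN_le) simp
  also have "\<dots> \<le> (\<Sum>d\<in>{k<..N}. N div d ^ 2)"
    by (intro sum_mono card_multiples_le) auto
  finally have "real (card {n \<in> {0<..N}. \<exists>d>k. d ^ 2 dvd n}) \<le> (\<Sum>d\<in>{k<..N}. real (N div d ^ 2))"
    by (simp flip: of_nat_sum)
  also have "\<dots> \<le> (\<Sum>d\<in>{k<..N}. N * (1 / real d ^ 2))"
    by (intro sum_mono) (use of_nat_div_le_of_nat[of N "_ ^ 2", where ?'a = real] in simp)
  also have "\<dots> \<le> N * (1 / k)"
    unfolding sum_distrib_left[symmetric]
    by (intro mult_left_mono sum_inverse_squares_tail_le assms) auto
  finally show ?thesis by simp
qed

section \<open>Proportions of periodic sets and comparison of proportions\<close>

definition proportion :: "(nat \<Rightarrow> bool) \<Rightarrow> real \<Rightarrow> real" where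
  "proportion P x = real (card {n. 0 < n \<and> real n \<le> x \<and> P n}) / x"

lemma positive_le_real_eq:
  "{n. 0 < n \<and> real n \<le> x \<and> P n} = {n \<in> {0<..nat \<lfloor>x\<rfloor>}. P n}"
  by (auto simp: le_nat_floor) linarith

text \<open>
  The counting function gains a fixed amount over each period, so its deviation from linear
  growth is itself periodic, and over one period it is at most \<open>Q\<close>.
\<close>

lemma card_periodic:
  fixes P :: "nat \<Rightarrow> bool" and N Q :: nat
  assumes "Q > 0" "\<And>n. P (n mod Q) = P n"
  shows "\<bar>real (card {n. n < N \<and> P n}) - N * (card {r. r < Q \<and> P r} / Q)\<bar> \<le> Q"
proof -
  define C where "C = (\<lambda>N. card {n. n < N \<and> P n})"
  have step: "C (Q + N) = C Q + C N" for N
  proof -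
    have P: "P (Q + n) = P n" for n using assms(2)[of "Q + n"] assms(2)[of n] by simp
    have "{n. n < Q + N \<and> P n} = {n. n < Q \<and> P n} \<union> (\<lambda>n. Q + n) ` {n. n < N \<and> P n}"
      (is "?A = ?B \<union> ?C")
    proof (intro equalityI subsetI)
      fix n assume n: "n \<in> ?A"
      show "n \<in> ?B \<union> ?C"
      proof (cases "n < Q")
        case False
        thus ?thesis using n P[of "n - Q"] by (intro UnI2 image_eqI[of _ _ "n - Q"]) auto
      qed (use n in auto)
    qed (auto simp: P)
    thus ?thesis unfolding C_def by (simp only:, subst card_Un_disjoint) (auto simp: card_image)
  qed
  have C_eq: "C (q * Q + s) = q * C Q + C s" for q s
    by (induction q) (simp_all add: step add.assoc)
  define q s where "q = N div Q" and "s = N mod Q"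
  have N: "N = q * Q + s" and s: "s < Q" using assms(1) by (auto simp: q_def s_def)
  have C_le: "C n \<le> n" for n
    unfolding C_def using card_mono[of "{..<n}" "{i. i < n \<and> P i}"] by auto
  have ratio: "C Q / Q \<le> 1" using C_le[of Q] assms(1) by (simp add: divide_le_eq)
  have "real (C N) - N * (C Q / Q) = C s - s * (C Q / Q)"
    unfolding N C_eq using assms(1) by (simp add: field_simps)
  moreover have "real (C s) \<le> Q" using C_le[of s] s by simp
  moreover have "s * (C Q / Q) \<le> real Q * 1" using s ratio by (intro mult_mono) auto
  moreover have "0 \<le> s * (C Q / Q)" by simp
  ultimately show ?thesis unfolding C_def by linarith
qed

lemma proportion_periodic_tendsto:
  assumes "Q > 0" "\<And>n. P (n mod Q) = P n"
  shows "(proportion P \<longlongrightarrow> card {r. r < Q \<and> P r} / Q) at_top"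
proof -
  define \<delta> where "\<delta> = card {r. r < Q \<and> P r} / Q"
  have \<delta>: "0 \<le> \<delta>" "\<delta> \<le> 1"
    using card_mono[of "{..<Q}" "{r. r < Q \<and> P r}"] assms(1)
    by (auto simp: \<delta>_def divide_le_eq)
  have bound: "norm (proportion P x - \<delta>) \<le> (real Q + 2) / x" if x: "x > 0" for x
  proof -
    define N where "N = Suc (nat \<lfloor>x\<rfloor>)"
    have N: "x \<le> N" "N \<le> x + 1" using x unfolding N_def by linarith+
    let ?c = "card {n. 0 < n \<and> real n \<le> x \<and> P n}" and ?C = "card {n. n < N \<and> P n}"
    have sub: "{n \<in> {0<..nat \<lfloor>x\<rfloor>}. P n} \<subseteq> {n. n < N \<and> P n}"
      "{n. n < N \<and> P n} \<subseteq> insert 0 {n \<in> {0<..nat \<lfloor>x\<rfloor>}. P n}" by (auto simp: N_def)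
    have "?c \<le> ?C" unfolding positive_le_real_eq using sub(1) by (intro card_mono) auto
    moreover have "?C \<le> Suc ?c"
      unfolding positive_le_real_eq using card_mono[OF _ sub(2)] by simp
    moreover have "\<bar>real ?C - N * \<delta>\<bar> \<le> Q"
      unfolding \<delta>_def using assms by (rule card_periodic)
    moreover have "x * \<delta> \<le> N * \<delta>" "N * \<delta> \<le> x * \<delta> + 1"
    proof -
      show "x * \<delta> \<le> N * \<delta>" using N \<delta> by (intro mult_right_mono) auto
      have "N * \<delta> \<le> (x + 1) * \<delta>" using N \<delta> by (intro mult_right_mono) auto
      thus "N * \<delta> \<le> x * \<delta> + 1" using \<delta> by (simp add: algebra_simps)
    qed
    ultimately have "\<bar>?c - x * \<delta>\<bar> \<le> real Q + 2" by linarith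
    moreover have "proportion P x - \<delta> = (?c - x * \<delta>) / x"
      using x by (simp add: proportion_def field_simps)
    ultimately show ?thesis using x by (simp add: divide_right_mono)
  qed
  have "eventually (\<lambda>x. norm (proportion P x - \<delta>) \<le> (real Q + 2) / x) at_top"
    using eventually_gt_at_top[of 0] by eventually_elim (rule bound)
  moreover have "((\<lambda>x. (real Q + 2) / x) \<longlongrightarrow> 0) at_top"
    by (intro real_tendsto_divide_at_top[OF tendsto_const] filterlim_ident)
  ultimately have "((\<lambda>x. proportion P x - \<delta>) \<longlongrightarrow> 0) at_top"
    by (rule Lim_null_comparison)
  thus ?thesis unfolding \<delta>_def by (rule LIM_zero_cancel)
qed

text \<open>
  An \<open>n\<close> with \<open>u n = v n\<close> contributes equally to both proportions for every \<open>m\<close>; any other \<open>n\<close> is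
  counted for one value of \<open>m\<close> by \<open>u\<close> and for one by \<open>v\<close>, whence the factor 2. The bound does not
  depend on \<open>M\<close>, and this gives control of whole generating functions.
\<close>

lemma sum_abs_proportion_diff_le:
  fixes u v :: "nat \<Rightarrow> nat"
  assumes "x > 0"
  shows "(\<Sum>m<M. \<bar>proportion (\<lambda>n. u n = m) x - proportion (\<lambda>n. v n = m) x\<bar>)
    \<le> 2 * proportion (\<lambda>n. u n \<noteq> v n) x"
proof -
  let ?S = "{0<..nat \<lfloor>x\<rfloor>}"
  have count: "proportion P x = (\<Sum>n\<in>?S. of_bool (P n)) / x" for P
    by (simp add: proportion_def positive_le_real_eq of_bool_def sum.If_cases Int_def)
  have single: "(\<Sum>m<M. \<bar>of_bool (a = m) - of_bool (b = m)\<bar>) \<le> 2 * (of_bool (a \<noteq> b) :: real)" for a b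
  proof (cases "a = b")
    case False
    have "(\<Sum>m<M. \<bar>of_bool (a = m) - of_bool (b = m)\<bar>) \<le>
        (\<Sum>m<M. of_bool (a = m)) + (\<Sum>m<M. of_bool (b = m) :: real)"
      unfolding sum.distrib[symmetric] by (intro sum_mono) auto
    also have "\<dots> \<le> 1 + 1" by (intro add_mono) (auto simp: of_bool_def)
    finally show ?thesis using False by simp
  qed simp
  have "(\<Sum>m<M. \<bar>proportion (\<lambda>n. u n = m) x - proportion (\<lambda>n. v n = m) x\<bar>) \<le>
     (\<Sum>m<M. (\<Sum>n\<in>?S. \<bar>of_bool (u n = m) - of_bool (v n = m)\<bar>) / x)"
    using assms unfolding count diff_divide_distrib[symmetric] sum_subtractf[symmetric]
    by (intro sum_mono) (simp add: divide_right_mono)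
  also have "\<dots> = (\<Sum>n\<in>?S. \<Sum>m<M. \<bar>of_bool (u n = m) - of_bool (v n = m)\<bar>) / x"
    by (subst sum.swap) (simp add: sum_divide_distrib)
  also have "\<dots> \<le> (\<Sum>n\<in>?S. 2 * of_bool (u n \<noteq> v n)) / x"
    using assms by (intro divide_right_mono sum_mono single) auto
  finally show ?thesis
    unfolding count[of "\<lambda>n. u n \<noteq> v n"] sum_distrib_left[symmetric]
    by (simp only: times_divide_eq_right)
qed

text \<open>
  Cauchy's criterion: for \<open>k\<close> large and fixed, \<open>f\<close> stays within \<open>2 / k\<close> of a function whose values are
  eventually close to one another.
\<close>

lemma tendsto_if_uniformly_approximated:
  fixes f :: "real \<Rightarrow> real"
  assumes approx: "\<And>k x. k > 0 \<Longrightarrow> x > 0 \<Longrightarrow> \<bar>f x - g k x\<bar> \<le> 2 / real k"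
    and lim: "\<And>k. (g k \<longlongrightarrow> L k) at_top"
  shows "\<exists>l. (f \<longlongrightarrow> l) at_top"
proof -
  have "\<exists>P. eventually P at_top \<and> (\<forall>x y. P x \<and> P y \<longrightarrow> dist (f x) (f y) < e)" if e: "e > 0" for e :: real
  proof -
    obtain k where k: "k > 0" "2 / real k < e / 4"
    proof -
      obtain k :: nat where "8 / e < k" using reals_Archimedean2 by blast
      moreover from this e have "0 < real k" by (smt (verit) divide_pos_pos)
      ultimately show ?thesis using e that[of k] by (simp add: field_simps)
    qed
    have "eventually (\<lambda>x. \<bar>g k x - L k\<bar> < e / 4 \<and> x > 0) at_top"
      using tendstoD[OF lim[of k], of "e / 4"] e eventually_gt_at_top[of 0]
      by (intro eventually_conj) (simp_all add: dist_real_def)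
    moreover have "dist (f x) (f y) < e"
      if "\<bar>g k x - L k\<bar> < e / 4 \<and> x > 0" "\<bar>g k y - L k\<bar> < e / 4 \<and> y > 0" for x y
      using approx[OF k(1), of x] approx[OF k(1), of y] that k(2) unfolding dist_real_def by linarith
    ultimately show ?thesis by blast
  qed
  hence "cauchy_filter (filtermap f at_top)"
    by (simp add: cauchy_filter_metric_filtermap)
  moreover have "complete (UNIV :: real set)" by (rule complete_UNIV)
  ultimately obtain l where "filtermap f at_top \<le> nhds l"
    using cauchy_filter_complete_converges[of "filtermap f at_top" UNIV] by (auto simp: filtermap_bot_iff)
  thus ?thesis by (auto simp: filterlim_def)
qed

section \<open>Densities and their generating function\<close>

definition truncated_density :: "(nat \<Rightarrow> nat) \<Rightarrow> nat \<Rightarrow> nat \<Rightarrow> real" where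
  "truncated_density A k m =
     card {r. r < cutoff_modulus k \<and> omega_seq A (gcd r (cutoff_modulus k)) = m} / cutoff_modulus k"

lemma proportion_truncated_tendsto:
  "(proportion (\<lambda>n. omega_seq A (gcd n (cutoff_modulus k)) = m) \<longlongrightarrow> truncated_density A k m) at_top"
  unfolding truncated_density_def
  by (intro proportion_periodic_tendsto) (auto simp: cutoff_modulus_pos)

lemma omega_proportion_eq: "omega_proportion A m = proportion (\<lambda>n. omega_seq A n = m)"
  by (rule ext) (simp add: omega_proportion_def proportion_def)

text \<open>
  Truncation changes the value only at integers with a square divisor \<open>d\<^sup>2\<close>, \<open>d > k\<close>, and at most
  \<open>x / k\<close> integers up to \<open>x\<close> have one.
\<close>

lemma sum_abs_omega_proportion_diff_le:
  assumes "A 1 = 0" "k > 0" "x > 0"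
  shows "(\<Sum>m<M. \<bar>omega_proportion A m x -
            proportion (\<lambda>n. omega_seq A (gcd n (cutoff_modulus k)) = m) x\<bar>) \<le> 2 / k"
proof -
  let ?u = "omega_seq A" and ?v = "\<lambda>n. omega_seq A (gcd n (cutoff_modulus k))"
  let ?N = "nat \<lfloor>x\<rfloor>"
  have "card {n \<in> {0<..?N}. ?u n \<noteq> ?v n} \<le> card {n \<in> {0<..?N}. \<exists>d>k. d ^ 2 dvd n}"
  proof (intro card_mono subsetI CollectI conjI)
    fix n assume "n \<in> {n \<in> {0<..?N}. ?u n \<noteq> ?v n}"
    thus "n \<in> {0<..?N}" "\<exists>d>k. d ^ 2 dvd n"
      using large_square_divisor_if_omega_seq_gcd_neq[of A n k] assms(1) by auto
  qed auto
  hence "real (card {n \<in> {0<..?N}. ?u n \<noteq> ?v n}) \<le> ?N / k"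
    using card_large_square_divisor_le[OF assms(2), of ?N] by linarith
  also have "\<dots> \<le> x / k" using assms by (intro divide_right_mono) auto
  finally have "proportion (\<lambda>n. ?u n \<noteq> ?v n) x \<le> x / k / x"
    using assms unfolding proportion_def positive_le_real_eq by (intro divide_right_mono) auto
  also have "\<dots> = 1 / k" using assms by simp
  finally show ?thesis
    using sum_abs_proportion_diff_le[OF assms(3), where u = ?u and v = ?v and M = M]
    unfolding omega_proportion_eq by linarith
qed

lemma omega_proportion_tendsto:
  assumes "A 1 = 0"
  shows "(omega_proportion A m \<longlongrightarrow> omega_density A m) at_top"
proof -
  have "\<exists>l. (omega_proportion A m \<longlongrightarrow> l) at_top"
  proof (rule tendsto_if_uniformly_approximated[OF _ proportion_truncated_tendsto])
    fix k :: nat and x :: real assume *: "k > 0" "x > 0"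
    let ?d = "\<lambda>m. \<bar>omega_proportion A m x - proportion (\<lambda>n. omega_seq A (gcd n (cutoff_modulus k)) = m) x\<bar>"
    have "?d m \<le> (\<Sum>m<Suc m. ?d m)" by (intro member_le_sum) auto
    also have "\<dots> \<le> 2 / k" using assms * by (rule sum_abs_omega_proportion_diff_le)
    finally show "?d m \<le> 2 / k" .
  qed
  then obtain l where l: "(omega_proportion A m \<longlongrightarrow> l) at_top" ..
  moreover have "omega_density A m = l"
    unfolding omega_density_def using l by (intro tendsto_Lim) auto
  ultimately show ?thesis by simp
qed

lemma sum_abs_density_diff_le:
  assumes "A 1 = 0" "k > 0"
  shows "(\<Sum>m<M. \<bar>omega_density A m - truncated_density A k m\<bar>) \<le> 2 / k"
proof (rule tendsto_upperbound)
  show "((\<lambda>x. \<Sum>m<M. \<bar>omega_proportion A m x -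
      proportion (\<lambda>n. omega_seq A (gcd n (cutoff_modulus k)) = m) x\<bar>) \<longlongrightarrow>
      (\<Sum>m<M. \<bar>omega_density A m - truncated_density A k m\<bar>)) at_top"
    using assms(1)
    by (intro tendsto_sum tendsto_rabs tendsto_diff omega_proportion_tendsto proportion_truncated_tendsto)
  show "eventually (\<lambda>x. (\<Sum>m<M. \<bar>omega_proportion A m x -
      proportion (\<lambda>n. omega_seq A (gcd n (cutoff_modulus k)) = m) x\<bar>) \<le> 2 / k) at_top"
    using eventually_gt_at_top[of 0]
    by eventually_elim (rule sum_abs_omega_proportion_diff_le[of A k, OF assms])
qed simp

lemma omega_density_subprobability:
  assumes "A 1 = 0"
  shows "(\<Sum>m<M. omega_density A m) \<le> 1" and "omega_density A m \<ge> 0"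
proof -
  have bound: "(\<Sum>m<M. omega_proportion A m x) \<le> 1" if "x > 0" for x
  proof -
    let ?S = "\<lambda>m. {n. 0 < n \<and> real n \<le> x \<and> omega_seq A n = m}"
    have fin: "finite (?S m)" for m unfolding positive_le_real_eq by simp
    have "(\<Sum>m<M. card (?S m)) = card (\<Union>m<M. ?S m)"
      using fin by (intro card_UN_disjoint[symmetric]) auto
    also have "\<dots> \<le> card {0<..nat \<lfloor>x\<rfloor>}"
      unfolding positive_le_real_eq by (intro card_mono) auto
    finally have "(\<Sum>m<M. card (?S m)) \<le> nat \<lfloor>x\<rfloor>" by simp
    moreover have "real (nat \<lfloor>x\<rfloor>) \<le> x" using that by (intro of_nat_floor) simp
    ultimately have "real (\<Sum>m<M. card (?S m)) \<le> x" by linarith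
    thus ?thesis
      using that by (simp add: omega_proportion_def divide_le_eq flip: sum_divide_distrib)
  qed
  have "eventually (\<lambda>x. (\<Sum>m<M. omega_proportion A m x) \<le> 1) at_top"
    using eventually_gt_at_top[of 0] by eventually_elim (rule bound)
  thus "(\<Sum>m<M. omega_density A m) \<le> 1"
    using tendsto_upperbound[OF tendsto_sum[OF omega_proportion_tendsto[of A, OF assms]]] by force
  have "eventually (\<lambda>x. omega_proportion A m x \<ge> 0) at_top"
    using eventually_gt_at_top[of 0] by eventually_elim (simp add: omega_proportion_def)
  thus "omega_density A m \<ge> 0"
    using tendsto_lowerbound[OF omega_proportion_tendsto[of A, OF assms]] by force
qed

lemma summable_density_series:
  fixes z :: complex
  assumes "A 1 = 0" "norm z \<le> 1"
  shows "summable (\<lambda>m. of_real (omega_density A m) * z ^ m)"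
proof -
  have "summable (omega_density A)"
    using omega_density_subprobability[of A, OF assms(1)] by (intro summableI_nonneg_bounded) auto
  moreover have "norm (of_real (omega_density A m) * z ^ m) \<le> omega_density A m" for m
    using omega_density_subprobability(2)[of A, OF assms(1), of m] assms(2)
    by (simp add: norm_mult norm_power mult_left_le power_le_one)
  ultimately show ?thesis by (rule summable_comparison_test')
qed

text \<open>
  On one period the truncated function takes finitely many values; grouping the residues by value turns
  the generating polynomial into a mean of a multiplicative function.
\<close>

lemma truncated_generating_function:
  fixes z :: complex
  assumes "\<And>r. r < cutoff_modulus k \<Longrightarrow> omega_seq A (gcd r (cutoff_modulus k)) < M"
  shows "(\<Sum>m<M. of_real (truncated_density A k m) * z ^ m) =
    gcd_mean (\<lambda>d. z ^ omega_seq A d) (cutoff_modulus k)"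
proof -
  let ?Q = "cutoff_modulus k" and ?v = "\<lambda>r. omega_seq A (gcd r (cutoff_modulus k))"
  have "(\<Sum>r<?Q. z ^ ?v r) = (\<Sum>m<M. \<Sum>r | r \<in> {..<?Q} \<and> ?v r = m. z ^ ?v r)"
    using assms by (intro sum.group[symmetric]) auto
  also have "\<dots> = (\<Sum>m<M. of_nat (card {r. r < ?Q \<and> ?v r = m}) * z ^ m)"
    by (intro sum.cong refl) simp
  finally show ?thesis
    by (simp add: gcd_mean_def truncated_density_def sum_divide_distrib)
qed

text \<open>
  The \<open>l\<^sup>1\<close> distance of the two sequences of densities is at most \<open>2 / k\<close> and \<open>\<bar>z\<bar> \<le> 1\<close>, so
  the power series differ by no more than that.
\<close>

lemma norm_density_series_minus_gcd_mean_le: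
  fixes z :: complex
  assumes "A 1 = 0" "norm z \<le> 1" "k > 0"
  shows "norm ((\<Sum>m. of_real (omega_density A m) * z ^ m) -
      gcd_mean (\<lambda>d. z ^ omega_seq A d) (cutoff_modulus k)) \<le> 2 / k"
proof -
  let ?Q = "cutoff_modulus k"
  let ?H = "gcd_mean (\<lambda>d. z ^ omega_seq A d) ?Q"
  \<comment> \<open>Beyond \<open>M0\<close> every truncated density vanishes, so a partial sum is already the whole
    truncated generating function.\<close>
  obtain M0 where M0: "\<And>r. r < ?Q \<Longrightarrow> omega_seq A (gcd r ?Q) < M0"
    using finite_nat_set_iff_bounded[of "(\<lambda>r. omega_seq A (gcd r ?Q)) ` {..<?Q}"] by auto
  have le: "norm ((\<Sum>m<M. of_real (omega_density A m) * z ^ m) - ?H) \<le> 2 / k" if "M \<ge> M0" for M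
  proof -
    have "?H = (\<Sum>m<M. of_real (truncated_density A k m) * z ^ m)"
      using M0 that by (intro truncated_generating_function[symmetric]) (meson less_le_trans)
    hence "norm ((\<Sum>m<M. of_real (omega_density A m) * z ^ m) - ?H) =
        norm (\<Sum>m<M. of_real (omega_density A m - truncated_density A k m) * z ^ m)"
      by (simp add: sum_subtractf algebra_simps)
    also have "\<dots> \<le> (\<Sum>m<M. \<bar>omega_density A m - truncated_density A k m\<bar>)"
    proof (rule sum_norm_le)
      fix m
      have "norm (of_real (omega_density A m - truncated_density A k m) * z ^ m) =
          \<bar>omega_density A m - truncated_density A k m\<bar> * norm z ^ m"
        by (simp only: norm_mult norm_of_real norm_power)
      also have "\<dots> \<le> \<bar>omega_density A m - truncated_density A k m\<bar>"
        using assms(2) by (simp add: mult_left_le power_le_one)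
      finally show "norm (of_real (omega_density A m - truncated_density A k m) * z ^ m)
        \<le> \<bar>omega_density A m - truncated_density A k m\<bar>" .
    qed
    also have "\<dots> \<le> 2 / k" using assms by (intro sum_abs_density_diff_le)
    finally show ?thesis .
  qed
  have "(\<lambda>M. norm ((\<Sum>m<M. of_real (omega_density A m) * z ^ m) - ?H)) \<longlonglongrightarrow>
      norm ((\<Sum>m. of_real (omega_density A m) * z ^ m) - ?H)"
    using summable_density_series[of A z, OF assms(1,2)]
    by (intro tendsto_norm tendsto_diff tendsto_const summable_LIMSEQ)
  thus ?thesis
    by (rule tendsto_upperbound) (auto intro: eventually_sequentiallyI[OF le])
qed

theorem theorem10:
  fixes A :: "nat \<Rightarrow> nat" and z :: complex
  assumes "A 1 = 0" and "norm z \<le> 1"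
  shows "(\<forall>m. (omega_proportion A m \<longlongrightarrow> omega_density A m) at_top) \<and>
         summable (\<lambda>m. of_real (omega_density A m) * z ^ m) \<and>
         convergent_prod (\<lambda>p. if prime p then euler_factor A z p else 1) \<and>
         (\<Sum>m. of_real (omega_density A m) * z ^ m) =
           (\<Prod>p. if prime p then euler_factor A z p else 1)"
proof (intro conjI allI)
  let ?H = "\<lambda>k. gcd_mean (\<lambda>d. z ^ omega_seq A d) (cutoff_modulus k)"
  let ?S = "\<Sum>m. of_real (omega_density A m) * z ^ m"
  have "(\<lambda>k. ?H k - ?S) \<longlonglongrightarrow> 0"
  proof (rule Lim_null_comparison[OF _ lim_const_over_n[of 2]])
    show "eventually (\<lambda>k. norm (?H k - ?S) \<le> 2 / real k) sequentially"
      using eventually_gt_at_top[of 0]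
    proof eventually_elim
      case (elim k)
      show ?case
        using norm_density_series_minus_gcd_mean_le[of A z k, OF assms elim] by (simp add: norm_minus_commute)
    qed
  qed
  hence "?H \<longlonglongrightarrow> ?S" by (rule LIM_zero_cancel)
  moreover have "?H \<longlonglongrightarrow> (\<Prod>p. if prime p then euler_factor A z p else 1)"
    using assms by (rule gcd_mean_cutoff_modulus_tendsto)
  ultimately show "?S = (\<Prod>p. if prime p then euler_factor A z p else 1)"
    by (rule LIMSEQ_unique)
qed (use assms in \<open>auto intro: omega_proportion_tendsto summable_density_series convergent_prod_euler_factor\<close>)

end
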